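(* Let $T\in\mathbb{C}^{m\times n}$ be a partial isometry and let $A\in\mathbb{C}^{m\times n}$. If $A$ is $T$-hermitian, then $A$ is $T$-normal.
   Context: $^*$ denotes the conjugate transpose. $T$ is a partial isometry if $T=TT^*T$. $A$ is $T$-hermitian if $A=TA^*T$. $A$ is $T$-normal if $A=TT^*A=AT^*T$ and $AA^*T=TA^*A$. *)

theory Defs
  imports "Jordan_Normal_Form.Schur_Decomposition"
begin

text \<open>The library constant \<^const>\<open>mat_adjoint\<close> is the conjugate transpose: it maps
  \<^term>\<open>carrier_mat m n\<close> to \<^term>\<open>carrier_mat n m\<close>, so for \<open>T\<close> and \<open>A\<close> in
  \<^term>\<open>carrier_mat m n\<close> all products below have matching dimensions.\<close>

definition partial_isometry :: "complex mat \<Rightarrow> bool" where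
  "partial_isometry T \<longleftrightarrow> T = T * mat_adjoint T * T"

definition T_hermitian :: "complex mat \<Rightarrow> complex mat \<Rightarrow> bool" where
  "T_hermitian T A \<longleftrightarrow> A = T * mat_adjoint A * T"

definition T_normal :: "complex mat \<Rightarrow> complex mat \<Rightarrow> bool" where
  "T_normal T A \<longleftrightarrow>
     A = T * mat_adjoint T * A \<and> A = A * mat_adjoint T * T \<and>
     A * mat_adjoint A * T = T * mat_adjoint A * A"

end

theory Submission
  imports Defs
begin

text \<open>
  Write \<open>S\<close> for the conjugate transpose of \<open>T\<close> and \<open>B\<close> for that of \<open>A\<close>, so that \<open>A = T B T\<close>
  because \<open>A\<close> is \<open>T\<close>-hermitian. The first two conditions of \<open>T\<close>-normality hold because \<open>A\<close>
  has a factor \<open>T\<close> at each end: the partial isometry law \<open>T S T = T\<close> absorbs \<open>T S\<close> into the left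
  one and \<open>S T\<close> into the right one. For the third, replacing the remaining \<open>A\<close> by \<open>T B T\<close> turns
  both \<open>A B T\<close> and \<open>T B A\<close> into the same word \<open>T B T B T\<close>.
  Only associativity enters, so the argument is given for arbitrary matrices \<open>S\<close> and \<open>B\<close>
  of the right shape.
\<close>

lemma sandwich_absorbs:
  fixes T S B A :: "'a :: semiring_0 mat"
  assumes T: "T \<in> carrier_mat m n" and S: "S \<in> carrier_mat n m" and B: "B \<in> carrier_mat n m"
    and TST: "T * S * T = T" and A: "A = T * B * T"
  shows "T * S * A = A" and "A * S * T = A"
proof -
  have TS: "T * S \<in> carrier_mat m m" and TB: "T * B \<in> carrier_mat m m"
    and BT: "B * T \<in> carrier_mat n n"
    using T S B by auto
  have A': "A = T * (B * T)"
    using A assoc_mult_mat[OF T B T] by simp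
  have "T * S * A = T * S * T * (B * T)"
    unfolding A' using assoc_mult_mat[OF TS T BT] by simp
  then show "T * S * A = A"
    by (simp add: TST A')
  have "A * S * T = T * B * (T * S * T)"
    unfolding A
    using assoc_mult_mat[OF TB T S] assoc_mult_mat[OF TB TS T] by simp
  then show "A * S * T = A"
    by (simp add: TST A)
qed

lemma sandwich_swap:
  fixes T B A :: "'a :: semiring_0 mat"
  assumes T: "T \<in> carrier_mat m n" and B: "B \<in> carrier_mat n m" and A: "A = T * B * T"
  shows "A * B * T = T * B * A"
proof -
  have TB: "T * B \<in> carrier_mat m m"
    using T B by auto
  show ?thesis
    unfolding A
    using assoc_mult_mat[OF TB T B] assoc_mult_mat[OF TB TB T] by simp
qed

lemma mat_adjoint_carrier:
  assumes "M \<in> carrier_mat m n"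
  shows "mat_adjoint M \<in> carrier_mat n m"
  using assms by (auto simp: mat_adjoint_def)

theorem theorem2p3:
  fixes m n :: nat and T A :: "complex mat"
  assumes "T \<in> carrier_mat m n"
    and "A \<in> carrier_mat m n"
    and "partial_isometry T"
    and "T_hermitian T A"
  shows "T_normal T A"
proof -
  note S = mat_adjoint_carrier[OF assms(1)] and B = mat_adjoint_carrier[OF assms(2)]
  have TST: "T * mat_adjoint T * T = T"
    using assms(3) unfolding partial_isometry_def by simp
  have A: "A = T * mat_adjoint A * T"
    using assms(4) unfolding T_hermitian_def .
  show ?thesis
    unfolding T_normal_def
    using sandwich_absorbs[OF assms(1) S B TST A] sandwich_swap[OF assms(1) B A] by simp
qed

end
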